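(* Let $X,Y\subset \mathbb{R}^n$ be two closed convex sets with nonempty intersection. Then, for any starting point $z^0\in \mathbb{R}^n$, the sequence $(z^k)_{k\in\mathbb{N}}$ defined by $$z^{k+1} := T(z^k)=\operatorname{circ}\big(z_{C}^{k},\, R_{X}(z_{C}^{k}),\, R_{Y}(z_{C}^{k})\big),$$ where $z_{C}^{k}:=\tfrac{1}{2}\big( z_{\mathrm{MAP}}^k + P_{X}(z_{\mathrm{MAP}}^k)\big)$ and $z_{\mathrm{MAP}}^k := P_{Y}P_{X}(z^{k})$, is Fejér monotone with respect to $X\cap Y$, and converges to a point in $X\cap Y$.
   Context: $P_X,P_Y$ denote the orthogonal projections onto $X,Y$ in $\mathbb{R}^n$ with the Euclidean norm $\|\cdot\|$, and $R_X:=2P_X-\mathrm{Id}$, $R_Y:=2P_Y-\mathrm{Id}$ the corresponding reflectors. For $z,v,w\in\mathbb{R}^n$, the circumcenter $\operatorname{circ}(z,v,w)$ is the point $p$ satisfying (i) $\|p-z\|=\|p-v\|=\|p-w\|$ and (ii) $p\in\operatorname{aff}\{z,v,w\}:=\{z+\alpha(v-z)+\beta(w-z)\mid \alpha,\beta\in\mathbb{R}\}$. It exists and is unique if $\{z,v,w\}$ has cardinality one or two; when the three points are distinct, it exists (and is then unique) only if they are not collinear. A sequence $(w^k)_{k\in\mathbb{N}}\subset\mathbb{R}^n$ is Fejér monotone with respect to a set $M\subset\mathbb{R}^n$ when $\|w^{k+1}-w\|\le\|w^k-w\|$ for all $w\in M$ and all $k\in\mathbb{N}$. *)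

theory Defs
  imports "HOL-Analysis.Analysis"
begin

text \<open>The orthogonal projection onto a nonempty closed convex set \<open>S\<close> is
  the library's \<^const>\<open>closest_point\<close>.\<close>

definition reflector :: "(real ^ 'n) set \<Rightarrow> real ^ 'n \<Rightarrow> real ^ 'n" where
  "reflector S x = 2 *\<^sub>R closest_point S x - x"

definition is_circumcenter ::
    "real ^ 'n \<Rightarrow> real ^ 'n \<Rightarrow> real ^ 'n \<Rightarrow> real ^ 'n \<Rightarrow> bool" where
  "is_circumcenter z v w p \<longleftrightarrow>
     norm (p - z) = norm (p - v) \<and> norm (p - v) = norm (p - w) \<and>
     p \<in> affine hull {z, v, w}"

lemma affine_hull_triple:
  fixes z v w :: "real ^ 'n"
  shows "affine hull {z, v, w} = {z + \<alpha> *\<^sub>R (v - z) + \<beta> *\<^sub>R (w - z) | \<alpha> \<beta>. True}"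
proof -
  have 1: "u *\<^sub>R z + a *\<^sub>R v + b *\<^sub>R w = z + a *\<^sub>R (v - z) + b *\<^sub>R (w - z)"
    if "u + a + b = 1" for u a b :: real
  proof -
    have u: "u = 1 - a - b" using that by simp
    show ?thesis unfolding u by (simp add: algebra_simps)
  qed
  show ?thesis
  proof (intro equalityI subsetI)
    fix x assume "x \<in> affine hull {z, v, w}"
    then obtain u a b where "u + a + b = 1" "x = u *\<^sub>R z + a *\<^sub>R v + b *\<^sub>R w"
      unfolding affine_hull_3 by blast
    then show "x \<in> {z + \<alpha> *\<^sub>R (v - z) + \<beta> *\<^sub>R (w - z) | \<alpha> \<beta>. True}"
      using 1 by blast
  next
    fix x assume "x \<in> {z + \<alpha> *\<^sub>R (v - z) + \<beta> *\<^sub>R (w - z) | \<alpha> \<beta>. True}"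
    then obtain a b where x: "x = z + a *\<^sub>R (v - z) + b *\<^sub>R (w - z)" by blast
    have "(1 - a - b) + a + b = 1" by simp
    moreover from 1[OF this] have "x = (1 - a - b) *\<^sub>R z + a *\<^sub>R v + b *\<^sub>R w"
      by (simp only: x)
    ultimately show "x \<in> affine hull {z, v, w}"
      unfolding affine_hull_3 by blast
  qed
qed

text \<open>\<open>circ\<close> is a total function; its value is unspecified when the
  three points have no circumcenter, i.e. when they are distinct and collinear.\<close>

definition circ :: "real ^ 'n \<Rightarrow> real ^ 'n \<Rightarrow> real ^ 'n \<Rightarrow> real ^ 'n" where
  "circ z v w = (THE p. is_circumcenter z v w p)"

definition z_MAP :: "(real ^ 'n) set \<Rightarrow> (real ^ 'n) set \<Rightarrow> real ^ 'n \<Rightarrow> real ^ 'n" where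
  "z_MAP X Y z = closest_point Y (closest_point X z)"

definition z_C :: "(real ^ 'n) set \<Rightarrow> (real ^ 'n) set \<Rightarrow> real ^ 'n \<Rightarrow> real ^ 'n" where
  "z_C X Y z = (1 / 2) *\<^sub>R (z_MAP X Y z + closest_point X (z_MAP X Y z))"

definition cCRM :: "(real ^ 'n) set \<Rightarrow> (real ^ 'n) set \<Rightarrow> real ^ 'n \<Rightarrow> real ^ 'n" where
  "cCRM X Y z = circ (z_C X Y z) (reflector X (z_C X Y z)) (reflector Y (z_C X Y z))"

definition Fejer_monotone :: "(nat \<Rightarrow> real ^ 'n) \<Rightarrow> (real ^ 'n) set \<Rightarrow> bool" where
  "Fejer_monotone x M \<longleftrightarrow> (\<forall>w\<in>M. \<forall>k. norm (x (Suc k) - w) \<le> norm (x k - w))"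

end

theory Submission
  imports Defs
begin

text \<open>
  Write \<open>c\<close> for the centralized point \<open>z_C\<close>, and \<open>u = c - P\<^sub>X c\<close>, \<open>v = c - P\<^sub>Y c\<close>
  for its two residuals, so that the three points to be circumscribed are \<open>c\<close>, \<open>c - 2 u\<close>
  and \<open>c - 2 v\<close>. A circumcenter is a point \<open>c - d\<close> with \<open>d\<close> in the span of \<open>u\<close> and \<open>v\<close>
  and \<open>\<langle>d, u\<rangle> = \<parallel>u\<parallel>\<^sup>2\<close>, \<open>\<langle>d, v\<rangle> = \<parallel>v\<parallel>\<^sup>2\<close>: it is the foot of the
  perpendicular from \<open>c\<close> to the intersection of the hyperplanes that, for nonzero
  residuals, support \<open>X\<close> at
  \<open>P\<^sub>X c\<close> and \<open>Y\<close> at \<open>P\<^sub>Y c\<close>.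

  The averaging that produces \<open>c\<close> serves to make \<open>\<langle>u, v\<rangle> \<le> 0\<close>. Indeed
  \<open>c\<close> lies halfway between the point \<open>m = z_MAP\<close> of \<open>Y\<close> and \<open>P\<^sub>X m\<close>, so it has the same
  projection on \<open>X\<close> as \<open>m\<close>, and \<open>m = c + u\<close> (\<open>z_C_residual\<close>); as \<open>m \<in> Y\<close>, the obtuse
  angle at \<open>P\<^sub>Y c\<close> gives \<open>\<langle>u + v, v\<rangle> \<le> 0\<close> (\<open>z_C_residuals_obtuse\<close>). With this
  sign, Cramer's rule solves the \<open>2 \<times> 2\<close> system for \<open>d\<close> with nonnegative coefficients;
  its determinant can vanish for nonzero \<open>u\<close>, \<open>v\<close> only if these point in opposite
  directions, which a common point of \<open>X\<close> and \<open>Y\<close> rules out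
  (\<open>ex_nonneg_combination\<close>). Nonnegative coefficients mean that \<open>c - d\<close> is the projection of
  \<open>c\<close> on the intersection of the two supporting half-spaces, not just of the
  hyperplanes. Since this intersection contains \<open>X \<inter> Y\<close>, the step from \<open>c\<close> to the
  circumcenter does not increase the distance to any common point (\<open>norm_cCRM_le\<close>).

  The steps from \<open>z\<close> to \<open>c\<close> are projections and one averaging, so they do not increase that
  distance either, and the first two projections decrease its square by at least
  \<open>\<parallel>z - P\<^sub>X z\<parallel>\<^sup>2 + \<parallel>P\<^sub>X z - m\<parallel>\<^sup>2\<close> (\<open>cCRM_decrease\<close>). Along the iteration these
  quantities tend to \<open>0\<close>, so every cluster point of the bounded sequence lies in both sets, and
  a Fejer monotone sequence converges to any cluster point that belongs to its target set
  (\<open>Fejer_monotone_subseq_limit\<close>).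
\<close>

section \<open>Projections\<close>

text \<open>The angle at the foot of a projection is obtuse, which sharpens nonexpansiveness
  towards points of \<open>S\<close> to a Pythagorean inequality.\<close>

lemma closest_point_pythagoras:
  fixes S :: "'a::euclidean_space set"
  assumes "closed S" "convex S" "s \<in> S"
  shows "(norm (closest_point S x - s))\<^sup>2 + (norm (x - closest_point S x))\<^sup>2 \<le> (norm (x - s))\<^sup>2"
proof -
  have "(x - closest_point S x) \<bullet> (s - closest_point S x) \<le> 0"
    by (rule closest_point_dot) (use assms in auto)
  then show ?thesis
    by (simp add: power2_norm_eq_inner algebra_simps inner_commute)
qed

lemma norm_closest_point_le:
  fixes S :: "'a::euclidean_space set"
  assumes "closed S" "convex S" "s \<in> S"
  shows "norm (closest_point S x - s) \<le> norm (x - s)"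
  using closest_point_pythagoras[OF assms, of x]
  by (smt (verit) norm_ge_zero power2_le_imp_le zero_le_power2)

text \<open>The half-space supporting \<open>S\<close> at \<open>P\<^sub>S x\<close>, written as a bound on the residual.\<close>

lemma residual_inner_le:
  fixes S :: "'a::euclidean_space set"
  assumes "closed S" "convex S" "s \<in> S"
  shows "(x - closest_point S x) \<bullet> (x - closest_point S x) \<le> (x - s) \<bullet> (x - closest_point S x)"
proof -
  have "(x - closest_point S x) \<bullet> (s - closest_point S x) \<le> 0"
    by (rule closest_point_dot) (use assms in auto)
  then show ?thesis by (simp add: algebra_simps inner_commute)
qed

text \<open>By the triangle inequality, the midpoint cannot have in \<open>S\<close> a point closer than
  \<open>P\<^sub>S x\<close>, or \<open>x\<close> would have one too.\<close>

lemma closest_point_midpoint: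
  fixes S :: "'a::euclidean_space set"
  assumes "closed S" "convex S" "S \<noteq> {}"
  shows "closest_point S ((1/2) *\<^sub>R (x + closest_point S x)) = closest_point S x"
proof -
  let ?p = "closest_point S x" and ?c = "(1/2) *\<^sub>R (x + closest_point S x)"
  have c1: "x - ?c = (1/2) *\<^sub>R (x - ?p)"
    by (rule euclidean_eqI) (simp add: inner_diff_left inner_add_left field_simps)
  have c2: "?c - ?p = (1/2) *\<^sub>R (x - ?p)"
    by (rule euclidean_eqI) (simp add: inner_diff_left inner_add_left field_simps)
  have xp: "dist x ?p = dist x ?c + dist ?c ?p"
    by (simp only: dist_norm c1 c2) simp
  have "dist ?c ?p \<le> dist ?c s" if "s \<in> S" for s
    using closest_point_le[OF assms(1) that, of x] dist_triangle[of x s ?c] xp by simp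
  then show ?thesis
    using closest_point_unique[OF assms(2,1) closest_point_in_set[OF assms(1,3)]] by metis
qed

section \<open>Circumcenters of a point and two reflections\<close>

text \<open>Equidistance from \<open>c\<close> and \<open>c - 2 u\<close> places \<open>t\<close> on their perpendicular bisector,
  a hyperplane with normal \<open>u\<close>; this turns the circumcenter into a linear system for the
  displacement \<open>c - t\<close>.\<close>

lemma is_circumcenter_iff:
  fixes c u v t :: "real ^ 'n"
  shows "is_circumcenter c (c - 2 *\<^sub>R u) (c - 2 *\<^sub>R v) t \<longleftrightarrow>
    (c - t) \<bullet> u = u \<bullet> u \<and> (c - t) \<bullet> v = v \<bullet> v \<and> (\<exists>a b. c - t = a *\<^sub>R u + b *\<^sub>R v)"
proof -
  have bisector: "norm (t - c) = norm (t - (c - 2 *\<^sub>R w)) \<longleftrightarrow> (c - t) \<bullet> w = w \<bullet> w" for w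
    unfolding norm_eq by (auto simp: algebra_simps inner_commute)
  have "t \<in> affine hull {c, c - 2 *\<^sub>R u, c - 2 *\<^sub>R v} \<longleftrightarrow> (\<exists>a b. c - t = a *\<^sub>R u + b *\<^sub>R v)"
  proof
    assume "t \<in> affine hull {c, c - 2 *\<^sub>R u, c - 2 *\<^sub>R v}"
    then obtain a b where "t = c + a *\<^sub>R (c - 2 *\<^sub>R u - c) + b *\<^sub>R (c - 2 *\<^sub>R v - c)"
      unfolding affine_hull_triple by blast
    then have "c - t = (2 * a) *\<^sub>R u + (2 * b) *\<^sub>R v"
      by (simp add: algebra_simps)
    then show "\<exists>a b. c - t = a *\<^sub>R u + b *\<^sub>R v" by blast
  next
    assume "\<exists>a b. c - t = a *\<^sub>R u + b *\<^sub>R v"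
    then obtain a b where "c - t = a *\<^sub>R u + b *\<^sub>R v" by blast
    then have "t = c - (a *\<^sub>R u + b *\<^sub>R v)"
      by (metis diff_diff_eq2 add_diff_cancel_left')
    then have "t = c + (a/2) *\<^sub>R (c - 2 *\<^sub>R u - c) + (b/2) *\<^sub>R (c - 2 *\<^sub>R v - c)"
      by (simp add: algebra_simps)
    then show "t \<in> affine hull {c, c - 2 *\<^sub>R u, c - 2 *\<^sub>R v}"
      unfolding affine_hull_triple by blast
  qed
  then show ?thesis
    using bisector[of u] bisector[of v] unfolding is_circumcenter_def by auto
qed

text \<open>The difference of two solutions lies in the span of \<open>u\<close> and \<open>v\<close> and is orthogonal
  to it.\<close>

lemma is_circumcenter_unique:
  fixes c u v s t :: "real ^ 'n"
  assumes "is_circumcenter c (c - 2 *\<^sub>R u) (c - 2 *\<^sub>R v) s"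
    and "is_circumcenter c (c - 2 *\<^sub>R u) (c - 2 *\<^sub>R v) t"
  shows "s = t"
proof -
  obtain a b a' b' where s: "c - s = a *\<^sub>R u + b *\<^sub>R v" and t: "c - t = a' *\<^sub>R u + b' *\<^sub>R v"
    using assms unfolding is_circumcenter_iff by blast
  have orth: "(s - t) \<bullet> u = 0" "(s - t) \<bullet> v = 0"
    using assms unfolding is_circumcenter_iff by (simp_all add: inner_diff_left)
  have "s - t = (c - t) - (c - s)" by simp
  also have "\<dots> = (a' - a) *\<^sub>R u + (b' - b) *\<^sub>R v"
    unfolding s t by (simp add: algebra_simps)
  finally have "(s - t) \<bullet> (s - t) = (s - t) \<bullet> ((a' - a) *\<^sub>R u + (b' - b) *\<^sub>R v)" by simp
  then show ?thesis using orth by (simp add: inner_add_right)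
qed

text \<open>The vector \<open>h\<close> stands for \<open>c - s\<close> with \<open>s\<close> a common point of the two half-spaces.
  Such a point prevents \<open>u\<close> and \<open>v\<close> from being antiparallel, and the obtuse angle between
  them makes all numerators in Cramer's rule nonnegative.\<close>

lemma ex_nonneg_combination:
  fixes u v h :: "'a::real_inner"
  assumes obtuse: "u \<bullet> v \<le> 0" and hu: "u \<bullet> u \<le> h \<bullet> u" and hv: "v \<bullet> v \<le> h \<bullet> v"
  obtains a b where "0 \<le> a" "0 \<le> b"
    "(a *\<^sub>R u + b *\<^sub>R v) \<bullet> u = u \<bullet> u" "(a *\<^sub>R u + b *\<^sub>R v) \<bullet> v = v \<bullet> v"
proof (cases "u = 0 \<or> v = 0")
  case True
  (* The system is diagonal, with right-hand side equal to the diagonal. *)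
  then show ?thesis using that[of 1 1] by auto
next
  case False
  define p q r where "p = u \<bullet> u" and "q = v \<bullet> v" and "r = u \<bullet> v"
  define D where "D = p * q - r * r"
  have pq: "p > 0" "q > 0" and r: "r \<le> 0" using False obtuse by (auto simp: p_def q_def r_def)
  (* The residual of u after projection on v, scaled by q, has squared norm q * D. *)
  let ?w = "q *\<^sub>R u - r *\<^sub>R v"
  have w: "?w \<bullet> ?w = q * D"
    by (simp add: D_def p_def q_def r_def inner_commute algebra_simps)
  have "?w \<noteq> 0"
  proof
    assume "?w = 0"
    then have "q * (h \<bullet> u) = r * (h \<bullet> v)"
      by (metis inner_scaleR_right eq_iff_diff_eq_0)
    moreover have "q * (h \<bullet> u) > 0"
      using pq hu by (intro mult_pos_pos) (simp_all add: p_def del: inner_gt_zero_iff)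
    moreover have "r * (h \<bullet> v) \<le> 0"
      using pq r hv by (intro mult_nonpos_nonneg) (simp_all add: q_def del: inner_gt_zero_iff)
    ultimately show False by simp
  qed
  then have "q * D > 0" using w by (metis inner_gt_zero_iff)
  then have D: "D > 0" using pq by (simp add: zero_less_mult_iff)
  define a b where "a = q * (p - r) / D" and "b = p * (q - r) / D"
  show ?thesis
  proof
    show "0 \<le> a" "0 \<le> b" using pq r D by (auto simp: a_def b_def)
    have "a * p + b * r = p" "a * r + b * q = q"
      using D unfolding a_def b_def
      by (simp_all add: field_simps) (simp_all add: D_def algebra_simps)
    then show "(a *\<^sub>R u + b *\<^sub>R v) \<bullet> u = u \<bullet> u" "(a *\<^sub>R u + b *\<^sub>R v) \<bullet> v = v \<bullet> v"
      unfolding p_def q_def r_def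
      by (simp_all only: inner_add_left inner_scaleR_left inner_commute[of v u])
  qed
qed

text \<open>With \<open>h = c - s\<close>: since \<open>a\<close> and \<open>b\<close> are nonnegative, \<open>s\<close> lies in the half-space
  through \<open>c - d\<close> with outer normal \<open>d\<close>, so moving \<open>c\<close> to its boundary along the normal
  does not take it away from \<open>s\<close>.\<close>

lemma norm_diff_nonneg_combination_le:
  fixes u v h :: "'a::real_inner"
  assumes hu: "u \<bullet> u \<le> h \<bullet> u" and hv: "v \<bullet> v \<le> h \<bullet> v" and ab: "0 \<le> a" "0 \<le> b"
    and d: "d = a *\<^sub>R u + b *\<^sub>R v" and du: "d \<bullet> u = u \<bullet> u" and dv: "d \<bullet> v = v \<bullet> v"
  shows "norm (h - d) \<le> norm h"
proof -
  have "(h - d) \<bullet> d = a * ((h - d) \<bullet> u) + b * ((h - d) \<bullet> v)"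
    unfolding d by (simp add: inner_add_right)
  also have "\<dots> \<ge> 0"
    using ab hu hv du dv by (simp add: inner_diff_left)
  finally have "(h - d) \<bullet> d \<ge> 0" .
  moreover have "h \<bullet> h = (h - d) \<bullet> (h - d) + 2 * ((h - d) \<bullet> d) + d \<bullet> d"
    by (simp add: algebra_simps inner_commute)
  ultimately show ?thesis unfolding norm_le by (smt (verit) inner_ge_zero)
qed

section \<open>One step of the iteration\<close>

lemma reflector_eq_minus_residual: "reflector S x = x - 2 *\<^sub>R (x - closest_point S x)"
  by (simp add: reflector_def scaleR_2)

context
  fixes X Y :: "(real ^ 'n) set"
  assumes X: "closed X" "convex X" and Y: "closed Y" "convex Y" and XY: "X \<inter> Y \<noteq> {}"
begin

lemma z_MAP_in: "z_MAP X Y x \<in> Y"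
  unfolding z_MAP_def using closest_point_in_set[OF Y(1)] XY by blast

text \<open>Projecting the midpoint back to the foot of \<open>z_MAP\<close> is what makes \<open>z_MAP\<close>, a point
  of \<open>Y\<close>, lie exactly one residual beyond \<open>z_C\<close>.\<close>

lemma z_C_residual:
  "z_MAP X Y x = z_C X Y x + (z_C X Y x - closest_point X (z_C X Y x))"
proof -
  have "closest_point X (z_C X Y x) = closest_point X (z_MAP X Y x)"
    unfolding z_C_def using closest_point_midpoint X XY by blast
  then show ?thesis by (simp add: z_C_def vec_eq_iff field_simps)
qed

text \<open>This is the obtuse angle at \<open>P\<^sub>Y c\<close> tested with the point \<open>c + u\<close> of \<open>Y\<close>; it even
  gives \<open>\<langle>u, v\<rangle> \<le> - \<parallel>v\<parallel>\<^sup>2\<close>.\<close>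

lemma z_C_residuals_obtuse:
  "(z_C X Y x - closest_point X (z_C X Y x)) \<bullet> (z_C X Y x - closest_point Y (z_C X Y x)) \<le> 0"
proof -
  let ?c = "z_C X Y x"
  let ?u = "?c - closest_point X ?c" and ?v = "?c - closest_point Y ?c"
  have "?v \<bullet> (z_MAP X Y x - closest_point Y ?c) \<le> 0"
    by (rule closest_point_dot[OF Y(2,1) z_MAP_in])
  moreover have "z_MAP X Y x - closest_point Y ?c = ?u + ?v"
    by (subst z_C_residual) simp
  ultimately have "?v \<bullet> ?u + ?v \<bullet> ?v \<le> 0" by (simp only: inner_add_right)
  then show ?thesis
    using inner_ge_zero[of ?v] inner_commute[of ?u ?v] by linarith
qed

text \<open>The coefficients do not depend on the common point \<open>s\<close> by which their existence is shown,
  so the distance estimate holds for all common points at once.\<close>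

lemma circumcenter_combination:
  fixes x :: "real ^ 'n"
  defines "c \<equiv> z_C X Y x"
  defines "u \<equiv> c - closest_point X c" and "v \<equiv> c - closest_point Y c"
  obtains a b where "0 \<le> a" "0 \<le> b"
    "(a *\<^sub>R u + b *\<^sub>R v) \<bullet> u = u \<bullet> u" "(a *\<^sub>R u + b *\<^sub>R v) \<bullet> v = v \<bullet> v"
    "is_circumcenter c (reflector X c) (reflector Y c) (c - (a *\<^sub>R u + b *\<^sub>R v))"
proof -
  obtain s where s: "s \<in> X" "s \<in> Y" using XY by blast
  obtain a b where ab: "0 \<le> a" "0 \<le> b"
    "(a *\<^sub>R u + b *\<^sub>R v) \<bullet> u = u \<bullet> u" "(a *\<^sub>R u + b *\<^sub>R v) \<bullet> v = v \<bullet> v"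
  proof (rule ex_nonneg_combination)
    show "u \<bullet> v \<le> 0" unfolding u_def v_def c_def by (rule z_C_residuals_obtuse)
    show "u \<bullet> u \<le> (c - s) \<bullet> u" unfolding u_def by (rule residual_inner_le[OF X s(1)])
    show "v \<bullet> v \<le> (c - s) \<bullet> v" unfolding v_def by (rule residual_inner_le[OF Y s(2)])
  qed
  moreover have "is_circumcenter c (reflector X c) (reflector Y c) (c - (a *\<^sub>R u + b *\<^sub>R v))"
    unfolding reflector_eq_minus_residual u_def[symmetric] v_def[symmetric] is_circumcenter_iff
    using ab by auto
  ultimately show ?thesis by (rule that)
qed

lemma ex1_circumcenter:
  "\<exists>!p. is_circumcenter (z_C X Y x) (reflector X (z_C X Y x)) (reflector Y (z_C X Y x)) p"
proof -
  obtain p where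
    p: "is_circumcenter (z_C X Y x) (reflector X (z_C X Y x)) (reflector Y (z_C X Y x)) p"
    by (rule circumcenter_combination)
  then show ?thesis
    by (rule ex1I)
      (rule is_circumcenter_unique[OF _ p[unfolded reflector_eq_minus_residual]],
        simp only: reflector_eq_minus_residual)
qed

lemma norm_cCRM_le:
  assumes s: "s \<in> X \<inter> Y"
  shows "norm (cCRM X Y x - s) \<le> norm (z_C X Y x - s)"
proof -
  define c u v where "c = z_C X Y x" and "u = c - closest_point X c" and "v = c - closest_point Y c"
  obtain a b where ab: "0 \<le> a" "0 \<le> b"
      "(a *\<^sub>R u + b *\<^sub>R v) \<bullet> u = u \<bullet> u" "(a *\<^sub>R u + b *\<^sub>R v) \<bullet> v = v \<bullet> v"
    and t: "is_circumcenter c (reflector X c) (reflector Y c) (c - (a *\<^sub>R u + b *\<^sub>R v))"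
    using circumcenter_combination[of x] unfolding c_def u_def v_def by blast
  have "cCRM X Y x = c - (a *\<^sub>R u + b *\<^sub>R v)"
    unfolding cCRM_def circ_def c_def[symmetric]
    using t ex1_circumcenter[of x, folded c_def] by (rule the1_equality[rotated])
  then have "cCRM X Y x - s = (c - s) - (a *\<^sub>R u + b *\<^sub>R v)" by simp
  moreover have "norm ((c - s) - (a *\<^sub>R u + b *\<^sub>R v)) \<le> norm (c - s)"
  proof (rule norm_diff_nonneg_combination_le[OF _ _ ab(1,2) refl ab(3,4)])
    show "u \<bullet> u \<le> (c - s) \<bullet> u" unfolding u_def using residual_inner_le[OF X] s by blast
    show "v \<bullet> v \<le> (c - s) \<bullet> v" unfolding v_def using residual_inner_le[OF Y] s by blast
  qed
  ultimately show ?thesis unfolding c_def by (simp only:)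
qed

lemma norm_z_C_le:
  assumes s: "s \<in> X \<inter> Y"
  shows "norm (z_C X Y x - s) \<le> norm (z_MAP X Y x - s)"
proof -
  let ?m = "z_MAP X Y x"
  have "z_C X Y x - s = (1/2) *\<^sub>R ((?m - s) + (closest_point X ?m - s))"
    by (simp add: z_C_def vec_eq_iff field_simps)
  then have "norm (z_C X Y x - s) \<le> (norm (?m - s) + norm (closest_point X ?m - s)) / 2"
    using norm_triangle_ineq[of "?m - s" "closest_point X ?m - s"] by simp
  also have "\<dots> \<le> norm (?m - s)"
    using norm_closest_point_le[OF X, of s ?m] s by simp
  finally show ?thesis .
qed

text \<open>The two projections leading from \<open>x\<close> to \<open>z_MAP\<close> give the quantitative decrease;
  the centralization and the circumcenter only have to preserve it.\<close>

lemma cCRM_decrease: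
  assumes s: "s \<in> X \<inter> Y"
  shows "(norm (cCRM X Y x - s))\<^sup>2 + (norm (x - closest_point X x))\<^sup>2
    + (norm (closest_point X x - z_MAP X Y x))\<^sup>2 \<le> (norm (x - s))\<^sup>2"
proof -
  have "norm (cCRM X Y x - s) \<le> norm (z_MAP X Y x - s)"
    using norm_cCRM_le[OF s] norm_z_C_le[OF s] by (rule order_trans)
  then have "(norm (cCRM X Y x - s))\<^sup>2 \<le> (norm (z_MAP X Y x - s))\<^sup>2"
    by (simp add: power_mono)
  moreover have "(norm (closest_point X x - s))\<^sup>2 + (norm (x - closest_point X x))\<^sup>2
      \<le> (norm (x - s))\<^sup>2"
    using closest_point_pythagoras[OF X] s by blast
  moreover have "(norm (z_MAP X Y x - s))\<^sup>2 + (norm (closest_point X x - z_MAP X Y x))\<^sup>2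
      \<le> (norm (closest_point X x - s))\<^sup>2"
    unfolding z_MAP_def using closest_point_pythagoras[OF Y] s by blast
  ultimately show ?thesis by linarith
qed

end

section \<open>Fejer monotonicity and convergence\<close>

lemma Fejer_monotone_decseq:
  assumes "Fejer_monotone x M" "w \<in> M"
  shows "decseq (\<lambda>k. norm (x k - w))"
  using assms unfolding Fejer_monotone_def decseq_Suc_iff by blast

text \<open>The distances to the cluster point \<open>l\<close> decrease, and they tend to \<open>0\<close> along the
  subsequence.\<close>

lemma Fejer_monotone_subseq_limit:
  assumes "Fejer_monotone x M" "l \<in> M" "strict_mono r" "(x \<circ> r) \<longlonglongrightarrow> l"
  shows "x \<longlonglongrightarrow> l"
proof (rule LIMSEQ_I)
  fix e :: real assume "e > 0"
  then obtain k where k: "norm (x (r k) - l) < e"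
    using LIMSEQ_D[OF assms(4)] by fastforce
  have "norm (x n - l) < e" if "n \<ge> r k" for n
    using decseqD[OF Fejer_monotone_decseq[OF assms(1,2)] that] k by simp
  then show "\<exists>no. \<forall>n\<ge>no. norm (x n - l) < e" by blast
qed

theorem theorem2p10:
  fixes X Y :: "(real ^ 'n) set" and z :: "nat \<Rightarrow> real ^ 'n"
  assumes "closed X" and "convex X" and "closed Y" and "convex Y"
    and "X \<inter> Y \<noteq> {}"
    and "\<And>k. z (Suc k) = cCRM X Y (z k)"
  shows "(\<forall>k. \<exists>!p. is_circumcenter (z_C X Y (z k)) (reflector X (z_C X Y (z k)))
                  (reflector Y (z_C X Y (z k))) p)
    \<and> Fejer_monotone z (X \<inter> Y)
    \<and> (\<exists>l\<in>X \<inter> Y. z \<longlonglongrightarrow> l)"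
proof (intro conjI allI)
  note hyps = assms(1-5)
  show "\<exists>!p. is_circumcenter (z_C X Y (z k)) (reflector X (z_C X Y (z k)))
                  (reflector Y (z_C X Y (z k))) p" for k
    by (rule ex1_circumcenter[OF hyps])
  have decrease: "(norm (z (Suc k) - s))\<^sup>2 + (norm (z k - closest_point X (z k)))\<^sup>2
    + (norm (closest_point X (z k) - z_MAP X Y (z k)))\<^sup>2 \<le> (norm (z k - s))\<^sup>2"
    if "s \<in> X \<inter> Y" for s k
    unfolding assms(6) by (rule cCRM_decrease[OF hyps that])
  have "norm (z (Suc k) - s) \<le> norm (z k - s)" if "s \<in> X \<inter> Y" for s k
    by (rule power2_le_imp_le) (use decrease[OF that, of k] in \<open>smt (verit) zero_le_power2\<close>, simp)
  then show fejer: "Fejer_monotone z (X \<inter> Y)" unfolding Fejer_monotone_def by blast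
  obtain s where s: "s \<in> X \<inter> Y" using assms(5) by blast
  note dec = Fejer_monotone_decseq[OF fejer s]
  (* Decreasing and bounded below, the distances converge; hence the per-step drops vanish. *)
  obtain L where "(\<lambda>k. norm (z k - s)) \<longlonglongrightarrow> L"
    using decseq_convergent[OF dec, of 0] by auto
  then have L: "(\<lambda>k. (norm (z k - s))\<^sup>2) \<longlonglongrightarrow> L\<^sup>2" by (rule tendsto_power)
  then have gap: "(\<lambda>k. (norm (z k - s))\<^sup>2 - (norm (z (Suc k) - s))\<^sup>2) \<longlonglongrightarrow> 0"
    using tendsto_diff[OF L LIMSEQ_Suc[OF L]] by simp
  have vanish: "f \<longlonglongrightarrow> 0"
    if le: "\<And>k. (norm (f k))\<^sup>2 \<le> (norm (z k - s))\<^sup>2 - (norm (z (Suc k) - s))\<^sup>2" for f :: "nat \<Rightarrow> real ^ 'n"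
  proof -
    have "(\<lambda>k. (norm (f k))\<^sup>2) \<longlonglongrightarrow> 0"
      by (rule tendsto_sandwich[OF _ _ tendsto_const gap]) (use le in auto)
    then have "(\<lambda>k. sqrt ((norm (f k))\<^sup>2)) \<longlonglongrightarrow> sqrt 0" by (rule tendsto_real_sqrt)
    then show ?thesis by (simp add: tendsto_norm_zero_iff)
  qed
  have toX: "(\<lambda>k. z k - closest_point X (z k)) \<longlonglongrightarrow> 0"
    by (rule vanish) (use decrease[OF s] in \<open>smt (verit) zero_le_power2\<close>)
  have "(\<lambda>k. closest_point X (z k) - z_MAP X Y (z k)) \<longlonglongrightarrow> 0"
    by (rule vanish) (use decrease[OF s] in \<open>smt (verit) zero_le_power2\<close>)
  from tendsto_add[OF toX this] have toY: "(\<lambda>k. z k - z_MAP X Y (z k)) \<longlonglongrightarrow> 0" by simp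
  have "z k \<in> cball s (norm (z 0 - s))" for k
    using decseqD[OF dec, of 0 k] by (simp add: dist_norm norm_minus_commute)
  then obtain l r where r: "strict_mono r" and l: "(z \<circ> r) \<longlonglongrightarrow> l"
    using compact_cball[of s "norm (z 0 - s)"] unfolding compact_def by meson
  have cluster: "l \<in> S"
    if "closed S" "\<And>k. f k \<in> S" "(\<lambda>k. z k - f k) \<longlonglongrightarrow> 0" for S and f :: "nat \<Rightarrow> real ^ 'n"
  proof -
    have "(\<lambda>k. z (r k) - (z (r k) - f (r k))) \<longlonglongrightarrow> l - 0"
      using tendsto_diff[OF l LIMSEQ_subseq_LIMSEQ[OF that(3) r]] by (simp add: o_def)
    then have "(\<lambda>k. f (r k)) \<longlonglongrightarrow> l" by simp
    then show ?thesis by (rule closed_sequentially[OF that(1) that(2)])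
  qed
  have "l \<in> X"
    by (rule cluster[OF assms(1) _ toX]) (use closest_point_in_set[OF assms(1)] assms(5) in blast)
  moreover have "l \<in> Y"
    by (rule cluster[OF assms(3) _ toY]) (rule z_MAP_in[OF hyps])
  ultimately have "l \<in> X \<inter> Y" by blast
  then show "\<exists>l\<in>X \<inter> Y. z \<longlonglongrightarrow> l"
    using Fejer_monotone_subseq_limit[OF fejer _ r l] by blast
qed

end
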